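(* Let $\alpha>0$ and $\gamma>0$, and let the characteristic function $f$ of the density $p$ satisfy $B(p;\alpha,\gamma)=\int e^{\gamma|t|^\alpha}|f(t)|\,dt<\infty$. Let $p_n=p_{n,h_n}$ be the sinc estimator with $$h_n=\Bigl\{\frac1\gamma\log(h_0n)\Bigr\}^{-1/\alpha},\qquad h_0>\frac1n.$$ Then $$\mathrm{MISE}(p_n)\le\frac1{2\pi n}\Bigl\{\frac{2}{\gamma^{1/\alpha}}(\log h_0+\log n)^{1/\alpha}+\frac{B(p;\alpha,\gamma)}{h_0}\Bigr\}.$$
   Context: Let $X_1,\dots,X_n$ be i.i.d. real random variables with probability density $p$ and characteristic function $f(t)=\int e^{itx}p(x)\,dx$. The sinc kernel is $K(x)=\frac{\sin x}{\pi x}$ (with $K(0)=1/\pi$); the sinc estimator with bandwidth $h>0$ is $p_{n,h}(x)=\frac1{nh}\sum_{j=1}^nK\bigl((x-X_j)/h\bigr)$, equivalently $p_{n,h}(x)=\frac1{2\pi}\int_{-1/h}^{1/h}e^{-itx}f_n(t)\,dt$ with $f_n(t)=\frac1n\sum_{j=1}^ne^{itX_j}$. Define $\mathrm{MISE}(p_{n,h})=\mathrm{E}\int\{p_{n,h}(x)-p(x)\}^2\,dx$. *)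

theory Defs
  imports "HOL-Probability.Probability"
begin

definition sinc_kernel :: "real \<Rightarrow> real" where
  "sinc_kernel x = (if x = 0 then 1 / pi else sin x / (pi * x))"

definition sinc_estimator :: "(nat \<Rightarrow> 'a \<Rightarrow> real) \<Rightarrow> nat \<Rightarrow> real \<Rightarrow> 'a \<Rightarrow> real \<Rightarrow> real" where
  "sinc_estimator X n h \<omega> x = 1 / (real n * h) * (\<Sum>j=1..n. sinc_kernel ((x - X j \<omega>) / h))"

definition density_cf :: "(real \<Rightarrow> real) \<Rightarrow> real \<Rightarrow> complex" where
  "density_cf p = char (density lborel (\<lambda>x. ennreal (p x)))"

(* Both integrals are extended nonnegative ones, so that a MISE that is not finite has the
   value \<infinity>, rather than the value 0 of a Bochner integral that does not exist. *)
definition MISE :: "'a measure \<Rightarrow> ('a \<Rightarrow> real \<Rightarrow> real) \<Rightarrow> (real \<Rightarrow> real) \<Rightarrow> ennreal" where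
  "MISE M q p = (\<integral>\<^sup>+\<omega>. (\<integral>\<^sup>+x. ennreal ((q \<omega> x - p x)\<^sup>2) \<partial>lborel) \<partial>M)"

(* An extended nonnegative integral as well, so that its finiteness is a genuine condition. *)
definition cf_exp_moment :: "(real \<Rightarrow> real) \<Rightarrow> real \<Rightarrow> real \<Rightarrow> ennreal" where
  "cf_exp_moment p \<alpha> \<gamma> =
     (\<integral>\<^sup>+t. ennreal (exp (\<gamma> * \<bar>t\<bar> powr \<alpha>) * cmod (density_cf p t)) \<partial>lborel)"

end

theory Submission
  imports Defs
begin

text \<open>The error \<open>p\<^sub>n - p\<close> is almost everywhere the inverse Fourier transform of
  \<open>g = f\<^sub>n \<cdot> 1\<^bsub>[-1/h, 1/h]\<^esub> - f\<close>, so by Plancherel the MISE is at most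
  \<open>1/(2\<pi>) \<integral> E \<bar>g\<bar>\<^sup>2\<close>. On \<open>[-1/h, 1/h]\<close> the integrand is the variance of an empirical mean, at most
  \<open>1/n\<close>; outside, \<open>\<bar>f\<bar>\<^sup>2 \<le> \<bar>f\<bar> \<le> exp (\<gamma>\<bar>t\<bar>\<^sup>\<alpha>) \<bar>f\<bar> / (h0 n)\<close>, because the choice of \<open>h\<close> makes
  \<open>exp (\<gamma> h\<^sup>-\<^sup>\<alpha>) = h0 n\<close>. Only the inequality half of Plancherel is needed, and only for integrable
  \<open>g\<close>: it follows from Fubini with a Gaussian weight in \<open>x\<close>.\<close>

section \<open>Real functions determined almost everywhere by their integrals over half-open
  intervals\<close>

lemma set_integrable_pos_neg:
  fixes f g :: "'a \<Rightarrow> real"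
  assumes "set_integrable M A f" "set_integrable M A g"
  shows "set_integrable M A (\<lambda>x. max 0 (f x) + max 0 (- g x))"
proof -
  have "integrable M (\<lambda>x. max 0 (indicator A x *\<^sub>R f x) + max 0 (- (indicator A x *\<^sub>R g x)))"
    using assms unfolding set_integrable_def by auto
  also have "(\<lambda>x. max 0 (indicator A x *\<^sub>R f x) + max 0 (- (indicator A x *\<^sub>R g x))) =
    (\<lambda>x. indicator A x *\<^sub>R (max 0 (f x) + max 0 (- g x)))"
    by (auto simp: fun_eq_iff split: split_indicator)
  finally show ?thesis unfolding set_integrable_def .
qed

text \<open>Levy inversion controls only masses of intervals; this turns such information into an
  identity of densities. Half-open intervals are stable under intersection and generate the Borel
  sets, so measures that agree on them are equal, and their densities then agree almost
  everywhere.\<close>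

lemma AE_eq_if_set_integral_Ioc_eq:
  fixes f g :: "real \<Rightarrow> real"
  assumes [measurable]: "f \<in> borel_measurable borel" "g \<in> borel_measurable borel"
    and f: "\<And>a b. a \<le> b \<Longrightarrow> set_integrable lborel {a<..b} f"
    and g: "\<And>a b. a \<le> b \<Longrightarrow> set_integrable lborel {a<..b} g"
    and eq: "\<And>a b. a \<le> b \<Longrightarrow> (LBINT x:{a<..b}. f x) = (LBINT x:{a<..b}. g x)"
  shows "AE x in lborel. f x = g x"
proof -
  \<comment> \<open>\<open>f = g\<close> is rewritten as \<open>u = v\<close> with \<open>u, v \<ge> 0\<close>, so that both sides are densities of measures.\<close>
  define u where "u x = max 0 (f x) + max 0 (- g x)" for x
  define v where "v x = max 0 (g x) + max 0 (- f x)" for x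
  have [measurable]: "u \<in> borel_measurable borel" "v \<in> borel_measurable borel"
    unfolding u_def v_def by measurable
  have u0: "u x \<ge> 0" and v0: "v x \<ge> 0" for x by (auto simp: u_def v_def)
  have uv: "u x - v x = f x - g x" for x by (auto simp: u_def v_def max_def)
  have ui: "set_integrable lborel {a<..b} u" if "a \<le> b" for a b
    unfolding u_def using that by (intro set_integrable_pos_neg f g)
  have vi: "set_integrable lborel {a<..b} v" if "a \<le> b" for a b
    unfolding v_def using that by (intro set_integrable_pos_neg f g)
  have em: "emeasure (density lborel (\<lambda>x. ennreal (w x))) {a<..b} = ennreal (LBINT x:{a<..b}. w x)"
    if [measurable]: "w \<in> borel_measurable borel" and w0: "\<And>x. w x \<ge> 0"
      and wi: "set_integrable lborel {a<..b} w" for w :: "real \<Rightarrow> real" and a b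
  proof -
    have "emeasure (density lborel (\<lambda>x. ennreal (w x))) {a<..b} =
        (\<integral>\<^sup>+x. ennreal (indicator {a<..b} x *\<^sub>R w x) \<partial>lborel)"
      by (subst emeasure_density) (auto intro!: nn_integral_cong split: split_indicator)
    also have "\<dots> = ennreal (LBINT x:{a<..b}. w x)"
      unfolding set_lebesgue_integral_def using w0 wi
      by (intro nn_integral_eq_integral) (auto simp: set_integrable_def)
    finally show ?thesis .
  qed
  have "density lborel (\<lambda>x. ennreal (u x)) = density lborel (\<lambda>x. ennreal (v x))"
  proof (rule measure_eqI_generator_eq[where \<Omega> = UNIV and E = "range (\<lambda>(a, b). {a<..b::real})"
        and A = "\<lambda>i. {- real i<..real i}"])
    show "Int_stable (range (\<lambda>(a, b). {a<..b::real}))"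
      by (auto simp: Int_stable_def)
    show "sets (density lborel (\<lambda>x. ennreal (u x))) = sigma_sets UNIV (range (\<lambda>(a, b). {a<..b}))"
      "sets (density lborel (\<lambda>x. ennreal (v x))) = sigma_sets UNIV (range (\<lambda>(a, b). {a<..b}))"
      by (simp_all add: borel_sigma_sets_Ioc)
    show "(\<Union>i. {- real i<..real i}) = UNIV"
    proof (safe; simp)
      fix x :: real
      obtain n :: nat where "\<bar>x\<bar> < real n" using reals_Archimedean2 by blast
      then show "\<exists>i. - real i < x \<and> x \<le> real i" by (intro exI[of _ n]) auto
    qed
    \<comment> \<open>Total mass may be infinite; integrability on bounded intervals gives the
      exhausting sequence of finite mass that the uniqueness theorem requires.\<close>
    show "emeasure (density lborel (\<lambda>x. ennreal (u x))) {- real i<..real i} \<noteq> \<infinity>" for i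
      by (subst em) (auto simp: u0 intro!: ui)
    fix X assume "X \<in> range (\<lambda>(a, b). {a<..b::real})"
    then obtain a b :: real where X: "X = {a<..b}" by auto
    show "emeasure (density lborel (\<lambda>x. ennreal (u x))) X = emeasure (density lborel (\<lambda>x. ennreal (v x))) X"
    proof (cases "a \<le> b")
      case True
      have "(LBINT x:{a<..b}. u x) - (LBINT x:{a<..b}. v x) = (LBINT x:{a<..b}. f x) - (LBINT x:{a<..b}. g x)"
        using True by (subst (1 2) set_integral_diff(2)[symmetric]) (auto simp: uv intro: f g ui vi)
      with eq[OF True] have "(LBINT x:{a<..b}. u x) = (LBINT x:{a<..b}. v x)" by simp
      then show ?thesis
        using True by (simp add: X em u0 v0 ui vi)
    qed (simp add: X)
  qed auto
  then have "AE x in lborel. ennreal (u x) = ennreal (v x)"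
    by (subst (asm) sigma_finite_measure.density_unique_iff[OF sigma_finite_lborel]) auto
  then show ?thesis
  proof eventually_elim
    case (elim x)
    then have "u x = v x" by (simp add: u0 v0)
    with uv[of x] show ?case by simp
  qed
qed

subsection \<open>The Fourier transform and the Plancherel inequality\<close>

text \<open>The substitution of \<open>\<sigma> * x\<close> for \<open>x\<close> reduces this to the
  characteristic function of the standard normal distribution.\<close>

lemma char_normal_density:
  assumes "\<sigma> > 0"
  shows "(\<integral>x. normal_density 0 \<sigma> x * iexp (u * x) \<partial>lborel) = of_real (exp (- (\<sigma> * u)\<^sup>2 / 2))"
proof -
  have "(\<integral>x. normal_density 0 \<sigma> x * iexp (u * x) \<partial>lborel) =
      \<sigma> * (\<integral>x. normal_density 0 \<sigma> (\<sigma> * x) * iexp (u * (\<sigma> * x)) \<partial>lborel)"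
    using assms by (subst lborel_integral_real_affine[where c = \<sigma> and t = 0])
      (auto simp: scaleR_conv_of_real)
  also have "\<dots> = (\<integral>x. \<sigma> * (normal_density 0 \<sigma> (\<sigma> * x) * iexp (u * (\<sigma> * x))) \<partial>lborel)"
    by (simp only: integral_mult_right_zero)
  also have "\<dots> = (\<integral>x. std_normal_density x * iexp (\<sigma> * u * x) \<partial>lborel)"
    using assms by (intro Bochner_Integration.integral_cong)
      (auto simp: normal_density_def power_mult_distrib real_sqrt_mult mult_ac)
  also have "\<dots> = char std_normal_distribution (\<sigma> * u)"
    unfolding char_def by (subst integral_density) (auto simp: scaleR_conv_of_real)
  also have "\<dots> = of_real (exp (- (\<sigma> * u)\<^sup>2 / 2))"
    by (simp add: char_std_normal_distribution)
  finally show ?thesis .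
qed

text \<open>The weight has height 1 at the origin rather than mass 1. It therefore tends to 1
  pointwise as \<open>\<sigma>\<close> grows, while its transform is \<open>2 * pi\<close> times a
  probability density for every \<open>\<sigma>\<close>, which is what makes the later bounds
  uniform in \<open>\<sigma>\<close>.\<close>

lemma fourier_gaussian_weight:
  assumes "\<sigma> > 0"
  shows "(\<integral>x. of_real (exp (- (x / \<sigma>)\<^sup>2 / 2)) * iexp (u * x) \<partial>lborel) =
    of_real (2 * pi * normal_density 0 (1 / \<sigma>) u)"
proof -
  have "(\<integral>x. of_real (exp (- (x / \<sigma>)\<^sup>2 / 2)) * iexp (u * x) \<partial>lborel) =
      (\<integral>x. of_real (\<sigma> * sqrt (2 * pi)) * (normal_density 0 \<sigma> x * iexp (u * x)) \<partial>lborel)"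
    using assms
    by (intro Bochner_Integration.integral_cong) (auto simp: normal_density_def real_sqrt_mult power_divide)
  also have "\<dots> = of_real (\<sigma> * sqrt (2 * pi)) * of_real (exp (- (\<sigma> * u)\<^sup>2 / 2))"
    using assms by (simp only: integral_mult_right_zero char_normal_density)
  also have "\<dots> = of_real (2 * pi * normal_density 0 (1 / \<sigma>) u)"
    using assms 
    by (simp add: normal_density_def real_sqrt_mult real_sqrt_divide power_mult_distrib
       power_divide field_simps flip: of_real_mult)
  finally show ?thesis .
qed

lemma integrable_gaussian_weight:
  assumes "\<sigma> > 0"
  shows "integrable lborel (\<lambda>x::real. exp (- (x / \<sigma>)\<^sup>2 / 2))"
proof -
  have "integrable lborel (\<lambda>x. \<sigma> * sqrt (2 * pi) * normal_density 0 \<sigma> x)"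
    using assms by (intro integrable_mult_right integrable_normal_density)
  also have "(\<lambda>x. \<sigma> * sqrt (2 * pi) * normal_density 0 \<sigma> x) = (\<lambda>x::real. exp (- (x / \<sigma>)\<^sup>2 / 2))"
    using assms by (auto simp: normal_density_def real_sqrt_mult power_divide)
  finally show ?thesis .
qed

text \<open>A non-integrable function has Bochner integral 0 by convention, and the bound is then
  trivial.\<close>

lemma norm_integral_le_nn_integral:
  fixes f :: "'a \<Rightarrow> 'b::{banach, second_countable_topology}"
  shows "ennreal (norm (integral\<^sup>L M f)) \<le> (\<integral>\<^sup>+x. ennreal (norm (f x)) \<partial>M)"
proof (cases "integrable M f")
  case True
  then show ?thesis by (rule integral_norm_bound_ennreal)
qed (simp add: not_integrable_integral_eq)

lemma integrable_iexp_mult: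
  fixes g :: "real \<Rightarrow> complex"
  assumes "integrable lborel g"
  shows "integrable lborel (\<lambda>t. g t * iexp (c * t))"
proof (rule Bochner_Integration.integrable_bound[OF assms])
  have [measurable]: "g \<in> borel_measurable borel"
    using assms by (simp add: borel_measurable_integrable[of lborel, simplified])
  show "(\<lambda>t. g t * iexp (c * t)) \<in> borel_measurable lborel" by measurable
qed (simp add: norm_mult)

lemma integrable_tensor:
  fixes f g :: "real \<Rightarrow> complex"
  assumes f: "integrable lborel f" and g: "integrable lborel g"
  shows "integrable (lborel \<Otimes>\<^sub>M lborel) (\<lambda>(x, y). f x * g y)"
proof -
  have [measurable]: "f \<in> borel_measurable borel" "g \<in> borel_measurable borel"
    using f g by (simp_all add: borel_measurable_integrable[of lborel, simplified])
  show ?thesis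
  proof (rule lborel_pair.Fubini_integrable)
    show "integrable lborel (\<lambda>x. \<integral>y. norm (case (x, y) of (x, y) \<Rightarrow> f x * g y) \<partial>lborel)"
      using f by (simp add: norm_mult)
  qed (use g in auto)
qed

text \<open>Writing \<open>\<bar>F x\<bar>\<close> squared as a double integral over
  \<open>(t, s)\<close> and integrating the weight over \<open>x\<close> first produces the kernel
  \<open>2 * pi * N t s\<close>. Since \<open>N\<close> has mass 1 in each variable,
  \<open>2ab \<le> a^2 + b^2\<close> bounds the resulting quadratic form by the squared norm of
  \<open>g\<close>, as in the Schur test.\<close>

lemma nn_integral_gaussian_weight_fourier_le:
  fixes g :: "real \<Rightarrow> complex"
  assumes g: "integrable lborel g" and \<sigma>: "\<sigma> > 0"
  shows "(\<integral>\<^sup>+x. ennreal (exp (- (x / \<sigma>)\<^sup>2 / 2) * (cmod (\<integral>t. g t * iexp (- (x * t)) \<partial>lborel))\<^sup>2) \<partial>lborel)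
    \<le> ennreal (2 * pi) * (\<integral>\<^sup>+t. ennreal ((cmod (g t))\<^sup>2) \<partial>lborel)"
proof -
  have [measurable]: "g \<in> borel_measurable borel"
    using g by (simp add: borel_measurable_integrable[of lborel, simplified])
  define w where "w x = exp (- (x / \<sigma>)\<^sup>2 / 2)" for x :: real
  have [measurable]: "w \<in> borel_measurable borel" unfolding w_def by measurable
  have w0: "w x \<ge> 0" for x by (simp add: w_def)
  have wi: "integrable lborel w" unfolding w_def using \<sigma> by (rule integrable_gaussian_weight)
  define F where "F x = (\<integral>t. g t * iexp (- (x * t)) \<partial>lborel)" for x
  have [measurable]: "F \<in> borel_measurable borel" unfolding F_def by measurable
  define N where "N t s = normal_density 0 (1 / \<sigma>) (s - t)" for t s
  have [measurable]: "case_prod N \<in> borel_measurable (lborel \<Otimes>\<^sub>M lborel)"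
    unfolding N_def by measurable
  have N1: "(\<integral>\<^sup>+s. ennreal (N t s) \<partial>lborel) = 1" "(\<integral>\<^sup>+t. ennreal (N t s) \<partial>lborel) = 1" for t s
  proof -
    \<comment> \<open>The kernel depends on \<open>s - t\<close> only and is even in it, so it is a
      normal density in either variable, centred at the other one.\<close>
    have *: "N t s = normal_density t (1 / \<sigma>) s" "N t s = normal_density s (1 / \<sigma>) t" for t s
      by (simp_all add: N_def normal_density_def power2_commute)
    show "(\<integral>\<^sup>+s. ennreal (N t s) \<partial>lborel) = 1"
      unfolding *(1) using \<sigma> by (subst nn_integral_eq_integral) auto
    show "(\<integral>\<^sup>+t. ennreal (N t s) \<partial>lborel) = 1"
      unfolding *(2) using \<sigma> by (subst nn_integral_eq_integral) auto
  qed
  define H where "H = (\<lambda>(t, s). g t * cnj (g s))"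
  have Hi: "integrable (lborel \<Otimes>\<^sub>M lborel) H"
    unfolding H_def using g by (intro integrable_tensor) auto
  have [measurable]: "H \<in> borel_measurable (lborel \<Otimes>\<^sub>M lborel)"
    using Hi by (rule borel_measurable_integrable)
  have F2: "of_real ((cmod (F x))\<^sup>2) = (\<integral>z. H z * iexp ((snd z - fst z) * x) \<partial>(lborel \<Otimes>\<^sub>M lborel))" for x
  proof -
    have cF: "cnj (F x) = (\<integral>s. cnj (g s) * iexp (x * s) \<partial>lborel)"
      unfolding F_def by (subst Bochner_Integration.integral_cnj[symmetric]) (simp add: exp_cnj)
    have i: "integrable (lborel \<Otimes>\<^sub>M lborel)
        (\<lambda>(t, s). (g t * iexp (- (x * t))) * (cnj (g s) * iexp (x * s)))"
      using g integrable_iexp_mult[of g "-x"] integrable_iexp_mult[of "\<lambda>s. cnj (g s)" x]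
      by (intro integrable_tensor) auto
    have "of_real ((cmod (F x))\<^sup>2) = F x * cnj (F x)"
      by (simp only: complex_norm_square)
    also have "\<dots> = (\<integral>t. (\<integral>s. (g t * iexp (- (x * t))) * (cnj (g s) * iexp (x * s)) \<partial>lborel) \<partial>lborel)"
      unfolding cF by (simp add: F_def)
    also have "\<dots> = (\<integral>z. (\<lambda>(t, s). (g t * iexp (- (x * t))) * (cnj (g s) * iexp (x * s))) z \<partial>(lborel \<Otimes>\<^sub>M lborel))"
      by (subst lborel_pair.integral_fst'[OF i, symmetric]) simp
    also have "\<dots> = (\<integral>z. H z * iexp ((snd z - fst z) * x) \<partial>(lborel \<Otimes>\<^sub>M lborel))"
      by (intro Bochner_Integration.integral_cong)
         (auto simp: H_def algebra_simps simp flip: exp_add)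
    finally show ?thesis .
  qed
  \<comment> \<open>\<open>F\<close> is bounded by the integral of \<open>norm (g t)\<close>, so the
    integrable weight dominates up to a constant.\<close>
  have F2i: "integrable lborel (\<lambda>x. w x * (cmod (F x))\<^sup>2)"
  proof (rule Bochner_Integration.integrable_bound)
    show "integrable lborel (\<lambda>x. w x * (\<integral>t. norm (g t) \<partial>lborel)\<^sup>2)"
      using wi by simp
    have "cmod (F x) \<le> (\<integral>t. norm (g t) \<partial>lborel)" for x
    proof -
      have "cmod (F x) \<le> (\<integral>t. norm (g t * iexp (- (x * t))) \<partial>lborel)"
        unfolding F_def by (rule integral_norm_bound)
      then show ?thesis by (simp add: norm_mult)
    qed
    then show "AE x in lborel. norm (w x * (cmod (F x))\<^sup>2) \<le> norm (w x * (\<integral>t. norm (g t) \<partial>lborel)\<^sup>2)"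
      by (intro AE_I2) (auto simp: w0 abs_mult intro!: mult_left_mono power_mono)
  qed measurable
  interpret Q: pair_sigma_finite "lborel \<Otimes>\<^sub>M lborel :: (real \<times> real) measure" "lborel :: real measure" 
    by (intro pair_sigma_finite.intro lborel_pair.sigma_finite_measure_axioms) (unfold_locales)
  \<comment> \<open>This is where the weight earns its place: the modulus of the integrand is
    \<open>norm (H z) * w x\<close>, a product of integrable functions, whereas the oscillating
    factor alone gives no decay in \<open>x\<close>.\<close>
  have joint: "integrable ((lborel \<Otimes>\<^sub>M lborel) \<Otimes>\<^sub>M lborel)
      (\<lambda>(z, x). H z * (of_real (w x) * iexp ((snd z - fst z) * x)))"
  proof (rule Q.Fubini_integrable)
    show "integrable (lborel \<Otimes>\<^sub>M lborel) (\<lambda>z. \<integral>x. norm (case (z, x) of (z, x) \<Rightarrow> 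
        H z * (of_real (w x) * iexp ((snd z - fst z) * x))) \<partial>lborel)"
      using Hi by (simp add: norm_mult)
    show "AE z in lborel \<Otimes>\<^sub>M lborel. integrable lborel (\<lambda>x. case (z, x) of (z, x) \<Rightarrow>
        H z * (of_real (w x) * iexp ((snd z - fst z) * x)))"
    proof (intro AE_I2)
      fix z :: "real \<times> real"
      show "integrable lborel (\<lambda>x. case (z, x) of (z, x) \<Rightarrow>
          H z * (of_real (w x) * iexp ((snd z - fst z) * x)))"
        using wi by (simp only: prod.case)
          (intro integrable_mult_right integrable_iexp_mult integrable_of_real)
    qed
  qed measurable
  have "of_real (\<integral>x. w x * (cmod (F x))\<^sup>2 \<partial>lborel) =
     (\<integral>x. (\<integral>z. H z * (of_real (w x) * iexp ((snd z - fst z) * x)) \<partial>(lborel \<Otimes>\<^sub>M lborel)) \<partial>lborel)"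
    unfolding integral_complex_of_real[symmetric] of_real_mult F2
    by (simp add: mult_ac flip: integral_mult_right_zero)
  also have "\<dots> = (\<integral>z. (\<integral>x. H z * (of_real (w x) * iexp ((snd z - fst z) * x)) \<partial>lborel) \<partial>(lborel \<Otimes>\<^sub>M lborel))"
    by (rule Q.Fubini_integral[OF joint])
  also have "\<dots> = (\<integral>z. H z * of_real (2 * pi * N (fst z) (snd z)) \<partial>(lborel \<Otimes>\<^sub>M lborel))"
    unfolding integral_mult_right_zero w_def N_def fourier_gaussian_weight[OF \<sigma>] ..
  finally have eq: "of_real (\<integral>x. w x * (cmod (F x))\<^sup>2 \<partial>lborel) =
      (\<integral>z. H z * of_real (2 * pi * N (fst z) (snd z)) \<partial>(lborel \<Otimes>\<^sub>M lborel))" .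
  have "(\<integral>\<^sup>+x. ennreal (w x * (cmod (F x))\<^sup>2) \<partial>lborel) = ennreal (\<integral>x. w x * (cmod (F x))\<^sup>2 \<partial>lborel)"
    using F2i by (intro nn_integral_eq_integral) (auto simp: w0)
  \<comment> \<open>From here on the estimates are in extended nonnegative integrals:
    \<open>g\<close> is integrable but possibly not square integrable, so the right-hand side may be
    infinite.\<close>
  also have "\<dots> = ennreal (norm (complex_of_real (\<integral>x. w x * (cmod (F x))\<^sup>2 \<partial>lborel)))"
    by (simp add: w0 integral_nonneg_AE)
  also have "\<dots> \<le> (\<integral>\<^sup>+z. norm (H z * of_real (2 * pi * N (fst z) (snd z))) \<partial>(lborel \<Otimes>\<^sub>M lborel))"
    unfolding eq
    by (rule norm_integral_le_nn_integral)
  also have "\<dots> \<le> (\<integral>\<^sup>+z. ennreal pi * (ennreal ((cmod (g (fst z)))\<^sup>2) * ennreal (N (fst z) (snd z)))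
      + ennreal pi * (ennreal ((cmod (g (snd z)))\<^sup>2) * ennreal (N (fst z) (snd z))) \<partial>(lborel \<Otimes>\<^sub>M lborel))"
  proof (rule nn_integral_mono)
    fix z :: "real \<times> real"
    obtain t s where z: "z = (t, s)" by (cases z)
    have "norm (H z * of_real (2 * pi * N t s)) = pi * N t s * (2 * cmod (g t) * cmod (g s))"
      by (simp add: H_def z norm_mult N_def)
    also have "\<dots> \<le> pi * N t s * ((cmod (g t))\<^sup>2 + (cmod (g s))\<^sup>2)"
      by (intro mult_left_mono sum_squares_bound) (auto simp: N_def)
    finally have "ennreal (norm (H z * of_real (2 * pi * N t s))) \<le>
        ennreal (pi * ((cmod (g t))\<^sup>2 * N t s) + pi * ((cmod (g s))\<^sup>2 * N t s))"
      by (intro ennreal_leI) (simp add: algebra_simps)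
    then show "ennreal (norm (H z * of_real (2 * pi * N (fst z) (snd z)))) \<le> 
       ennreal pi * (ennreal ((cmod (g (fst z)))\<^sup>2) * ennreal (N (fst z) (snd z)))
      + ennreal pi * (ennreal ((cmod (g (snd z)))\<^sup>2) * ennreal (N (fst z) (snd z)))"
      by (simp add: z ennreal_mult' N_def)
  qed
  also have "\<dots> = ennreal pi * (\<integral>\<^sup>+z. ennreal ((cmod (g (fst z)))\<^sup>2) * ennreal (N (fst z) (snd z)) \<partial>(lborel \<Otimes>\<^sub>M lborel))
      + ennreal pi * (\<integral>\<^sup>+z. ennreal ((cmod (g (snd z)))\<^sup>2) * ennreal (N (fst z) (snd z)) \<partial>(lborel \<Otimes>\<^sub>M lborel))"
    by (simp add: nn_integral_add nn_integral_cmult)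
  \<comment> \<open>In each of the two terms the variable on which \<open>g\<close> does not depend
    is integrated first, and \<open>N\<close> contributes the factor 1.\<close>
  also have "(\<integral>\<^sup>+z. ennreal ((cmod (g (fst z)))\<^sup>2) * ennreal (N (fst z) (snd z)) \<partial>(lborel \<Otimes>\<^sub>M lborel))
      = (\<integral>\<^sup>+t. ennreal ((cmod (g t))\<^sup>2) \<partial>lborel)"
    by (subst lborel.nn_integral_fst[symmetric]) (auto simp: nn_integral_cmult N1)
  also have "(\<integral>\<^sup>+z. ennreal ((cmod (g (snd z)))\<^sup>2) * ennreal (N (fst z) (snd z)) \<partial>(lborel \<Otimes>\<^sub>M lborel))
      = (\<integral>\<^sup>+t. ennreal ((cmod (g t))\<^sup>2) \<partial>lborel)"
    by (subst lborel_pair.nn_integral_snd[symmetric]) (auto simp: nn_integral_cmult N1 split_beta')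
  also have "ennreal pi * (\<integral>\<^sup>+t. ennreal ((cmod (g t))\<^sup>2) \<partial>lborel) + ennreal pi * (\<integral>\<^sup>+t. ennreal ((cmod (g t))\<^sup>2) \<partial>lborel)
      = ennreal (2 * pi) * (\<integral>\<^sup>+t. ennreal ((cmod (g t))\<^sup>2) \<partial>lborel)"
    by (simp only: mult_2 ennreal_plus[OF pi_ge_zero pi_ge_zero] distrib_right)
  finally show ?thesis unfolding w_def F_def .
qed

text \<open>The weighted bound is the same for every width, so Fatou's lemma removes the weight as
  the width tends to infinity.\<close>

lemma nn_integral_fourier_le:
  fixes g :: "real \<Rightarrow> complex"
  assumes g: "integrable lborel g"
  shows "(\<integral>\<^sup>+x. ennreal ((cmod (\<integral>t. g t * iexp (- (x * t)) \<partial>lborel))\<^sup>2) \<partial>lborel)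
    \<le> ennreal (2 * pi) * (\<integral>\<^sup>+t. ennreal ((cmod (g t))\<^sup>2) \<partial>lborel)"
proof -
  have [measurable]: "g \<in> borel_measurable borel"
    using g by (simp add: borel_measurable_integrable[of lborel, simplified])
  define F where "F x = (\<integral>t. g t * iexp (- (x * t)) \<partial>lborel)" for x
  have [measurable]: "F \<in> borel_measurable borel" unfolding F_def by measurable
  \<comment> \<open>The width is \<open>Suc k\<close> rather than \<open>k\<close> because the
    weighted bound requires \<open>\<sigma> > 0\<close>.\<close>
  define u where "u k x = ennreal (exp (- (x / real (Suc k))\<^sup>2 / 2) * (cmod (F x))\<^sup>2)" for k x
  have [measurable]: "u k \<in> borel_measurable borel" for k unfolding u_def by measurable
  have lim: "(\<lambda>k. u k x) \<longlonglongrightarrow> ennreal ((cmod (F x))\<^sup>2)" for x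
  proof -
    have "(\<lambda>k. exp (- (x / real (Suc k))\<^sup>2 / 2) * (cmod (F x))\<^sup>2) \<longlonglongrightarrow> exp (- 0\<^sup>2 / 2) * (cmod (F x))\<^sup>2"
      by (intro tendsto_intros LIMSEQ_Suc[OF lim_const_over_n]) simp
    then show ?thesis unfolding u_def by (intro tendsto_ennrealI) simp
  qed
  have "(\<integral>\<^sup>+x. ennreal ((cmod (F x))\<^sup>2) \<partial>lborel) = (\<integral>\<^sup>+x. liminf (\<lambda>k. u k x) \<partial>lborel)"
    using lim_imp_Liminf[OF sequentially_bot lim] by simp
  also have "\<dots> \<le> liminf (\<lambda>k. \<integral>\<^sup>+x. u k x \<partial>lborel)"
    by (intro nn_integral_liminf) simp
  also have "\<dots> \<le> liminf (\<lambda>k. ennreal (2 * pi) * (\<integral>\<^sup>+t. ennreal ((cmod (g t))\<^sup>2) \<partial>lborel))"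
    unfolding u_def F_def
    by (intro Liminf_mono always_eventually allI nn_integral_gaussian_weight_fourier_le g) simp
  finally show ?thesis unfolding F_def by (simp add: Liminf_const)
qed

subsection \<open>Fourier inversion for densities\<close>

text \<open>The quotient is the kernel in Levy's inversion formula; as an integral over
  \<open>x\<close> it is visibly bounded and open to Fubini. At \<open>t = 0\<close> the quotient
  has the default value 0 while the integral is \<open>b - a\<close>.\<close>

lemma set_integral_iexp:
  assumes "t \<noteq> 0" "a \<le> b"
  shows "(CLBINT x:{a<..b}. iexp (- (t * x))) = (iexp (- (t * a)) - iexp (- (t * b))) / (\<i> * t)"
proof -
  have "(CLBINT x:{a<..b}. iexp (- (t * x))) = (CLBINT x=a..b. iexp (- (t * x)))"
    using assms by (simp add: interval_integral_Ioc)
  also have "\<dots> = \<i> / t * iexp (- (t * b)) - \<i> / t * iexp (- (t * a))"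
    using assms
    by (intro interval_integral_FTC_finite)
       (auto intro!: continuous_intros derivative_eq_intros
         simp: has_vector_derivative_complex_iff Re_exp Im_exp)
  also have "\<dots> = (iexp (- (t * a)) - iexp (- (t * b))) / (\<i> * t)"
    using assms by (simp add: divide_simps) (simp add: algebra_simps)
  finally show ?thesis .
qed

lemma set_integrable_iexp: "set_integrable lborel {a<..b} (\<lambda>x. iexp (- (t * x)))"
  unfolding set_integrable_def
  by (rule Bochner_Integration.integrable_bound[of _ "indicator {a<..b} :: real \<Rightarrow> real"])
     (cases "a \<le> b"; auto split: split_indicator)+

lemma cmod_set_integral_iexp_le:
  assumes "a \<le> b"
  shows "cmod (CLBINT x:{a<..b}. iexp (- (t * x))) \<le> b - a"
proof -
  have "cmod (CLBINT x:{a<..b}. iexp (- (t * x))) \<le> (LBINT x:{a<..b}. cmod (iexp (- (t * x))))"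
    by (rule set_integral_norm_bound[OF set_integrable_iexp])
  also have "\<dots> = b - a"
    using assms by (simp add: set_lebesgue_integral_def)
  finally show ?thesis .
qed

text \<open>Levy inversion gives a limit of integrals over \<open>{-T..T}\<close>. The kernel is at
  most \<open>b - a\<close> in modulus and \<open>char M\<close> is integrable, so dominated
  convergence replaces the limit by an integral over the whole line.\<close>

lemma (in real_distribution) measure_Ioc_eq_integral_char:
  assumes int: "integrable lborel (char M)" and ab: "a \<le> b" and "measure M {a} = 0" "measure M {b} = 0"
  shows "measure M {a<..b} =
    1 / (2 * pi) * (\<integral>t. (CLBINT x:{a<..b}. iexp (- (t * x))) * char M t \<partial>lborel)"
proof (rule LIMSEQ_unique)
  define G where "G t = (CLBINT x:{a<..b}. iexp (- (t * x)))" for t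
  have [measurable]: "G \<in> borel_measurable borel"
    unfolding G_def set_lebesgue_integral_def by measurable
  show "(\<lambda>T. 1 / (2 * pi) * (CLBINT t=-T..T. (iexp (-(t * a)) - iexp (-(t * b))) / (\<i> * t) * char M t))
    \<longlonglongrightarrow> measure M {a<..b}"
    by (rule Levy_Inversion) fact+
  have eq: "(CLBINT t=-T..T. (iexp (-(t * a)) - iexp (-(t * b))) / (\<i> * t) * char M t) =
      (\<integral>t. indicator {-real T..real T} t *\<^sub>R (G t * char M t) \<partial>lborel)" for T :: nat
  proof -
    have "(CLBINT t=-T..T. (iexp (-(t * a)) - iexp (-(t * b))) / (\<i> * t) * char M t) =
       (CLBINT t:{-real T..real T}. (iexp (-(t * a)) - iexp (-(t * b))) / (\<i> * t) * char M t)"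
      by (simp only: uminus_ereal.simps(1) of_int_minus of_int_of_nat_eq) (rule interval_integral_Icc; simp)
    also have "\<dots> = (\<integral>t. indicator {-real T..real T} t *\<^sub>R (G t * char M t) \<partial>lborel)"
      unfolding set_lebesgue_integral_def
    proof (rule integral_cong_AE)
      \<comment> \<open>Only the null set \<open>{0}\<close>, where the quotient takes its default
        value, has to be discarded.\<close>
      show "AE t in lborel. indicator {-real T..real T} t *\<^sub>R ((iexp (-(t * a)) - iexp (-(t * b))) / (\<i> * t) * char M t)
          = indicator {-real T..real T} t *\<^sub>R (G t * char M t)"
        using AE_lborel_singleton[of 0]
        by eventually_elim (simp only: G_def set_integral_iexp[OF _ ab] not_False_eq_True)
    qed measurable
    finally show ?thesis .
  qed
  have "(\<lambda>T. \<integral>t. indicator {-real T..real T} t *\<^sub>R (G t * char M t) \<partial>lborel)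
      \<longlonglongrightarrow> (\<integral>t. G t * char M t \<partial>lborel)"
  proof (rule integral_dominated_convergence[where w = "\<lambda>t. (b - a) * cmod (char M t)"])
    show "AE t in lborel. (\<lambda>T. indicator {-real T..real T} t *\<^sub>R (G t * char M t)) \<longlonglongrightarrow> G t * char M t"
    proof (intro AE_I2 tendsto_eventually)
      fix t :: real
      have "\<forall>\<^sub>F T in sequentially. \<bar>t\<bar> \<le> real T"
        using eventually_ge_at_top[of "nat \<lceil>\<bar>t\<bar>\<rceil>"] by eventually_elim linarith
      then show "\<forall>\<^sub>F T in sequentially. indicator {-real T..real T} t *\<^sub>R (G t * char M t) = G t * char M t"
        by eventually_elim (auto simp: indicator_def)
    qed
    show "AE t in lborel. norm (indicator {-real T..real T} t *\<^sub>R (G t * char M t)) \<le> (b - a) * cmod (char M t)" for T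
      using cmod_set_integral_iexp_le[OF ab] ab
      by (intro AE_I2) (auto simp: norm_mult G_def indicator_def intro!: mult_right_mono)
  qed (use int in auto)
  then show "(\<lambda>T. 1 / (2 * pi) * (CLBINT t=-T..T. (iexp (-(t * a)) - iexp (-(t * b))) / (\<i> * t) * char M t))
    \<longlonglongrightarrow> 1 / (2 * pi) * (\<integral>t. (CLBINT x:{a<..b}. iexp (- (t * x))) * char M t \<partial>lborel)"
    unfolding eq G_def by (intro tendsto_intros)
qed

text \<open>By Levy inversion and Fubini, \<open>p\<close> and the real part of its candidate
  inverse transform \<open>q\<close> have the same integral over every half-open interval, hence
  agree almost everywhere.\<close>

lemma AE_density_eq_inverse_fourier:
  fixes p :: "real \<Rightarrow> real"
  assumes [measurable]: "p \<in> borel_measurable borel" and p0: "\<And>x. p x \<ge> 0"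
    and prob: "prob_space (density lborel (\<lambda>x. ennreal (p x)))"
    and int: "integrable lborel (char (density lborel (\<lambda>x. ennreal (p x))))"
  shows "AE x in lborel. p x = Re (1 / (2 * pi) *
    (\<integral>t. char (density lborel (\<lambda>x. ennreal (p x))) t * iexp (- (x * t)) \<partial>lborel))"
proof -
  define M where "M = density lborel (\<lambda>x. ennreal (p x))"
  interpret M: prob_space M using prob by (simp add: M_def)
  interpret M: real_distribution M by unfold_locales (simp_all add: M_def)
  define f where "f = char M"
  have fi: "integrable lborel f" using int by (simp add: f_def M_def)
  have [measurable]: "f \<in> borel_measurable borel" by (simp add: f_def)
  define q where "q x = 1 / (2 * pi) * (\<integral>t. f t * iexp (- (x * t)) \<partial>lborel)" for x
  have [measurable]: "q \<in> borel_measurable borel" unfolding q_def by measurable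
  \<comment> \<open>A crude bound, dropping the factor \<open>1 / (2 * pi)\<close>, suffices: it
    only serves integrability of \<open>q\<close> on bounded intervals.\<close>
  have q_bound: "cmod (q x) \<le> (\<integral>t. cmod (f t) \<partial>lborel)" for x
  proof -
    have "cmod (\<integral>t. f t * iexp (- (x * t)) \<partial>lborel) \<le> (\<integral>t. norm (f t * iexp (- (x * t))) \<partial>lborel)"
      by (rule integral_norm_bound)
    also have "\<dots> = (\<integral>t. cmod (f t) \<partial>lborel)" by (simp add: norm_mult)
    finally have "cmod (q x) \<le> 1 / (2 * pi) * (\<integral>t. cmod (f t) \<partial>lborel)"
      unfolding q_def norm_mult by (intro mult_mono) (auto simp: norm_divide)
    also have "\<dots> \<le> 1 * (\<integral>t. cmod (f t) \<partial>lborel)"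
      using pi_ge_two by (intro mult_right_mono) (auto simp: divide_simps)
    finally show ?thesis by simp
  qed
  have qi: "set_integrable lborel {a<..b} q" for a b
    unfolding set_integrable_def
  proof (rule Bochner_Integration.integrable_bound)
    show "integrable lborel (\<lambda>x. (\<integral>t. cmod (f t) \<partial>lborel) * indicator {a<..b} x)"
      by (cases "a \<le> b") auto
  qed (use q_bound in \<open>auto split: split_indicator intro: order_trans[OF _ abs_ge_self]\<close>)
  have "(\<integral>\<^sup>+x. ennreal (p x) \<partial>lborel) = 1"
    using M.emeasure_space_1 by (simp add: M_def emeasure_density)
  then have pi: "integrable lborel p"
    by (intro integrableI_nonneg) (auto simp: p0)
  have "AE x in lborel. p x = Re (q x)"
  proof (rule AE_eq_if_set_integral_Ioc_eq)
    fix a b :: real assume ab: "a \<le> b"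
    show "set_integrable lborel {a<..b} p"
      unfolding set_integrable_def using pi by (intro integrable_mult_indicator) auto
    show "set_integrable lborel {a<..b} (\<lambda>x. Re (q x))"
      using integrable_Re[OF qi[of a b, unfolded set_integrable_def]]
      by (simp add: set_integrable_def)
    \<comment> \<open>A distribution with a density has no atoms, so every pair of endpoints is
      admissible in the inversion formula.\<close>
    have "measure M {c} = 0" for c
      unfolding M_def by (subst measure_density_const | simp add: measure_def emeasure_density)+
    then have "of_real (measure M {a<..b}) =
        1 / (2 * pi) * (\<integral>t. (CLBINT x:{a<..b}. iexp (- (t * x))) * f t \<partial>lborel)"
      unfolding f_def using fi by (intro M.measure_Ioc_eq_integral_char ab) (simp_all add: f_def)
    also have "(\<integral>t. (CLBINT x:{a<..b}. iexp (- (t * x))) * f t \<partial>lborel) =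
        (\<integral>t. (\<integral>x. indicator {a<..b} x * f t * iexp (- (x * t)) \<partial>lborel) \<partial>lborel)"
      by (simp add: set_lebesgue_integral_def scaleR_conv_of_real mult_ac of_real_indicator
          flip: integral_mult_left_zero)
    also have "\<dots> = (\<integral>x. (\<integral>t. indicator {a<..b} x * f t * iexp (- (x * t)) \<partial>lborel) \<partial>lborel)"
    proof (rule lborel_pair.Fubini_integral)
      have "integrable lborel (\<lambda>x. complex_of_real (indicator {a<..b} x))"
        using ab by (intro integrable_of_real) simp
      note integrable_tensor[OF this fi]
      then show "integrable (lborel \<Otimes>\<^sub>M lborel) (\<lambda>(x, t). indicator {a<..b} x * f t * iexp (- (x * t)))"
        by (rule Bochner_Integration.integrable_bound)
           (auto simp: norm_mult of_real_indicator intro!: AE_I2)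
    qed
    also have "1 / (2 * pi) * \<dots> = (CLBINT x:{a<..b}. q x)"
      by (simp add: set_lebesgue_integral_def q_def scaleR_conv_of_real mult_ac of_real_indicator
        flip: integral_mult_right_zero)
    finally have "measure M {a<..b} = Re (CLBINT x:{a<..b}. q x)"
      by (metis Re_complex_of_real)
    also have "\<dots> = (LBINT x:{a<..b}. Re (q x))"
      using qi[of a b] unfolding set_lebesgue_integral_def set_integrable_def
      by (subst integral_Re[symmetric]) auto
    also have "measure M {a<..b} = (LBINT x:{a<..b}. p x)"
    proof -
      have "emeasure M {a<..b} = (\<integral>\<^sup>+x. ennreal (indicator {a<..b} x *\<^sub>R p x) \<partial>lborel)"
        unfolding M_def by (subst emeasure_density) (auto intro!: nn_integral_cong split: split_indicator)
      then show ?thesis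
        unfolding set_lebesgue_integral_def measure_def
        by (subst integral_eq_nn_integral) (auto simp: p0)
    qed
    finally show "(LBINT x:{a<..b}. p x) = (LBINT x:{a<..b}. Re (q x))" .
  qed simp_all
  then show ?thesis by (simp add: q_def f_def M_def)
qed

subsection \<open>The empirical characteristic function and the sinc estimator\<close>

lemma borel_measurable_cnj [measurable]: "cnj \<in> borel_measurable borel"
  by (intro borel_measurable_continuous_onI continuous_intros)

text \<open>The scaled kernel is the inverse Fourier transform of the indicator of
  \<open>{-(1/h)..1/h}\<close>. The antiderivative divides by \<open>u\<close>; at
  \<open>u = 0\<close> the interval length \<open>2 / h\<close> matches the value
  \<open>1 / pi\<close> in the kernel's definition.\<close>

lemma sinc_kernel_eq_integral:
  assumes "h > 0"
  shows "of_real (sinc_kernel (u / h) / h) =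
    1 / (2 * pi) * (CLBINT t:{-(1/h)..1/h}. iexp (- (u * t)))"
proof (cases "u = 0")
  case True
  then show ?thesis
    using assms by (simp add: sinc_kernel_def set_lebesgue_integral_def scaleR_conv_of_real)
next
  case False
  have "(CLBINT t:{-(1/h)..1/h}. iexp (- (u * t))) = (CLBINT t=-(1/h)..1/h. iexp (- (u * t)))"
    using assms by (simp add: interval_integral_Icc)
  also have "\<dots> = \<i> / u * iexp (- (u * (1/h))) - \<i> / u * iexp (- (u * (-(1/h))))"
    using assms False
    by (intro interval_integral_FTC_finite)
       (auto intro!: continuous_intros derivative_eq_intros
         simp: has_vector_derivative_complex_iff Re_exp Im_exp)
  also have "\<dots> = of_real (2 * sin (u / h) / u)"
    using assms False by (auto simp: complex_eq_iff Re_exp Im_exp field_simps)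
  finally show ?thesis
    using assms False by (simp add: sinc_kernel_def field_simps)
qed

lemma (in prob_space) expectation_mult_cnj_indep:
  fixes X :: "'i \<Rightarrow> 'a \<Rightarrow> real" and z :: "real \<Rightarrow> complex"
  assumes ind: "indep_vars (\<lambda>_. borel) X I" and jk: "j \<in> I" "k \<in> I" "j \<noteq> k"
    and [measurable]: "z \<in> borel_measurable borel"
    and int: "\<And>i. i \<in> I \<Longrightarrow> integrable M (\<lambda>\<omega>. z (X i \<omega>))"
  shows "(\<integral>\<omega>. z (X j \<omega>) * cnj (z (X k \<omega>)) \<partial>M) = (\<integral>\<omega>. z (X j \<omega>) \<partial>M) * cnj (\<integral>\<omega>. z (X k \<omega>) \<partial>M)"
proof -
  \<comment> \<open>One indexed family carries both factors, so that the product rule for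
    independent families applies to \<open>{j, k}\<close>.\<close>
  define Y where "Y i x = (if i = j then z x else cnj (z x))" for i x
  have [measurable]: "Y i \<in> borel_measurable borel" for i unfolding Y_def by simp
  have "indep_vars (\<lambda>_. borel) (\<lambda>i \<omega>. Y i (X i \<omega>)) {j, k}"
    using jk by (intro indep_vars_compose2[OF indep_vars_subset[OF ind]]) auto
  moreover have "integrable M (\<lambda>\<omega>. Y i (X i \<omega>))" if "i \<in> {j, k}" for i
    using that jk int[of i] by (auto simp: Y_def)
  ultimately have
    "(\<integral>\<omega>. (\<Prod>i\<in>{j,k}. Y i (X i \<omega>)) \<partial>M) = (\<Prod>i\<in>{j,k}. \<integral>\<omega>. Y i (X i \<omega>) \<partial>M)"
    by (intro indep_vars_lebesgue_integral) auto
  then show ?thesis using jk by (simp add: Y_def)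
qed

text \<open>Independent centred terms are orthogonal: in the expanded double sum the off-diagonal
  expectations factor into means, which vanish.\<close>

lemma (in prob_space) expectation_norm_sum_indep:
  fixes X :: "'i \<Rightarrow> 'a \<Rightarrow> real" and z :: "real \<Rightarrow> complex"
  assumes ind: "indep_vars (\<lambda>_. borel) X I" and fin: "finite I"
    and [measurable]: "z \<in> borel_measurable borel"
    and bnd: "\<And>x. cmod (z x) \<le> B"
    and mean: "\<And>i. i \<in> I \<Longrightarrow> (\<integral>\<omega>. z (X i \<omega>) \<partial>M) = 0"
  shows "(\<integral>\<omega>. (cmod (\<Sum>i\<in>I. z (X i \<omega>)))\<^sup>2 \<partial>M) = (\<Sum>i\<in>I. \<integral>\<omega>. (cmod (z (X i \<omega>)))\<^sup>2 \<partial>M)"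
proof -
  have [measurable]: "X i \<in> borel_measurable M" if "i \<in> I" for i
    using ind that by (auto simp: indep_vars_def)
  have B0: "B \<ge> 0" using order_trans[OF norm_ge_zero bnd] .
  have int: "integrable M (\<lambda>\<omega>. z (X i \<omega>))" if "i \<in> I" for i
    using that by (intro integrable_const_bound[where B = B]) (auto simp: bnd)
  have int2: "integrable M (\<lambda>\<omega>. z (X i \<omega>) * cnj (z (X k \<omega>)))" if "i \<in> I" "k \<in> I" for i k
    using that by (intro integrable_const_bound[where B = "B * B"])
      (auto simp: norm_mult bnd B0 intro!: mult_mono)
  have "complex_of_real (\<integral>\<omega>. (cmod (\<Sum>i\<in>I. z (X i \<omega>)))\<^sup>2 \<partial>M) =
      (\<integral>\<omega>. (\<Sum>i\<in>I. \<Sum>k\<in>I. z (X i \<omega>) * cnj (z (X k \<omega>))) \<partial>M)"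
    by (simp only: integral_complex_of_real[symmetric] complex_norm_square cnj_sum sum_product)
  also have "\<dots> = (\<Sum>i\<in>I. \<Sum>k\<in>I. \<integral>\<omega>. z (X i \<omega>) * cnj (z (X k \<omega>)) \<partial>M)"
    using int2 by (simp add: Bochner_Integration.integral_sum Bochner_Integration.integrable_sum)
  also have "\<dots> = (\<Sum>i\<in>I. \<Sum>k\<in>I. if k = i then \<integral>\<omega>. z (X i \<omega>) * cnj (z (X i \<omega>)) \<partial>M else 0)"
    using ind int mean by (intro sum.cong refl) (auto simp: expectation_mult_cnj_indep)
  also have "\<dots> = (\<Sum>i\<in>I. \<integral>\<omega>. z (X i \<omega>) * cnj (z (X i \<omega>)) \<partial>M)"
    using fin by simp
  also have "\<dots> = of_real (\<Sum>i\<in>I. \<integral>\<omega>. (cmod (z (X i \<omega>)))\<^sup>2 \<partial>M)"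
    by (simp only: complex_norm_square[symmetric] integral_complex_of_real of_real_sum)
  finally show ?thesis by (simp only: of_real_eq_iff)
qed

text \<open>Each centred term has variance \<open>1 - \<bar>c\<bar>^2 \<le> 1\<close> because
  \<open>iexp\<close> has modulus 1; averaging \<open>card I\<close> independent terms divides by
  \<open>card I\<close>.\<close>

lemma (in prob_space) expectation_empirical_char_le:
  fixes X :: "'i \<Rightarrow> 'a \<Rightarrow> real"
  assumes ind: "indep_vars (\<lambda>_. borel) X I" and fin: "finite I" and ne: "I \<noteq> {}"
    and mean: "\<And>i. i \<in> I \<Longrightarrow> (\<integral>\<omega>. iexp (t * X i \<omega>) \<partial>M) = c"
  shows "(\<integral>\<^sup>+\<omega>. ennreal ((cmod ((\<Sum>i\<in>I. iexp (t * X i \<omega>)) / of_nat (card I) - c))\<^sup>2) \<partial>M)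
    \<le> ennreal (1 / card I)"
proof -
  have [measurable]: "X i \<in> borel_measurable M" if "i \<in> I" for i
    using ind that by (auto simp: indep_vars_def)
  define n where "n = card I"
  have n: "n > 0" using fin ne by (simp add: n_def card_gt_0_iff)
  define z where "z x = iexp (t * x) - c" for x
  have [measurable]: "z \<in> borel_measurable borel" unfolding z_def by measurable
  have int: "integrable M (\<lambda>\<omega>. iexp (t * X i \<omega>))" if "i \<in> I" for i
    using that by (intro integrable_const_bound[where B = 1]) auto
  have mz: "(\<integral>\<omega>. z (X i \<omega>) \<partial>M) = 0" if "i \<in> I" for i
    using that int[OF that] mean[OF that] by (simp add: z_def prob_space)
  have bnd: "cmod (z x) \<le> 1 + cmod c" for x
    unfolding z_def by (rule order_trans[OF norm_triangle_ineq4]) simp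
  have var: "(\<integral>\<omega>. (cmod (z (X i \<omega>)))\<^sup>2 \<partial>M) \<le> 1" if i: "i \<in> I" for i
  proof -
    have zi: "integrable M (\<lambda>\<omega>. z (X i \<omega>))"
      using int[OF i] by (simp add: z_def)
    \<comment> \<open>With \<open>e\<close> of modulus 1,
      \<open>\<bar>e - c\<bar>^2 = 1 - c * cnj e - cnj c * (e - c)\<close>. The last term is kept in
      centred form so that its expectation is 0.\<close>
    have "complex_of_real (\<integral>\<omega>. (cmod (z (X i \<omega>)))\<^sup>2 \<partial>M) =
        (\<integral>\<omega>. 1 - c * cnj (iexp (t * X i \<omega>)) - cnj c * z (X i \<omega>) \<partial>M)"
      unfolding integral_complex_of_real[symmetric]
      by (intro Bochner_Integration.integral_cong)
         (auto simp only: complex_norm_square z_def complex_cnj_diff, 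
           auto simp: algebra_simps exp_cnj simp flip: exp_add)
    also have "\<dots> = 1 - c * cnj c"
      using int[OF i] mean[OF i] mz[OF i] zi
      by (simp add: prob_space del: exp_cnj)
    also have "\<dots> = of_real (1 - (cmod c)\<^sup>2)"
      by (simp add: complex_norm_square del: of_real_power)
    finally have "(\<integral>\<omega>. (cmod (z (X i \<omega>)))\<^sup>2 \<partial>M) = 1 - (cmod c)\<^sup>2"
      by (simp only: of_real_eq_iff)
    then show ?thesis by simp
  qed
  have "(\<integral>\<^sup>+\<omega>. ennreal ((cmod ((\<Sum>i\<in>I. iexp (t * X i \<omega>)) / of_nat n - c))\<^sup>2) \<partial>M) =
      (\<integral>\<^sup>+\<omega>. ennreal (1 / (real n)\<^sup>2 * (cmod (\<Sum>i\<in>I. z (X i \<omega>)))\<^sup>2) \<partial>M)"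
  proof (intro nn_integral_cong arg_cong[where f = ennreal])
    fix \<omega>
    have "(\<Sum>i\<in>I. iexp (t * X i \<omega>)) / of_nat n - c = (\<Sum>i\<in>I. z (X i \<omega>)) / of_nat n"
      using n by (simp add: z_def sum_subtractf n_def diff_divide_distrib)
    then show "(cmod ((\<Sum>i\<in>I. iexp (t * X i \<omega>)) / of_nat n - c))\<^sup>2 =
        1 / (real n)\<^sup>2 * (cmod (\<Sum>i\<in>I. z (X i \<omega>)))\<^sup>2"
      by (simp add: norm_divide power_divide)
  qed
  also have "\<dots> = ennreal (\<integral>\<omega>. 1 / (real n)\<^sup>2 * (cmod (\<Sum>i\<in>I. z (X i \<omega>)))\<^sup>2 \<partial>M)"
  proof (rule nn_integral_eq_integral)
    have "cmod (\<Sum>i\<in>I. z (X i \<omega>)) \<le> n * (1 + cmod c)" for \<omega>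
      using sum_norm_bound[of I "\<lambda>i. z (X i \<omega>)" "1 + cmod c"] bnd by (simp add: n_def)
    then show "integrable M (\<lambda>\<omega>. 1 / (real n)\<^sup>2 * (cmod (\<Sum>i\<in>I. z (X i \<omega>)))\<^sup>2)"
      by (intro integrable_mult_right integrable_const_bound[where B = "(n * (1 + cmod c))\<^sup>2"])
         (auto intro!: power_mono)
  qed simp
  also have "\<dots> = ennreal (1 / (real n)\<^sup>2 * (\<Sum>i\<in>I. \<integral>\<omega>. (cmod (z (X i \<omega>)))\<^sup>2 \<partial>M))"
    using expectation_norm_sum_indep[OF ind fin _ bnd mz] by simp
  also have "\<dots> \<le> ennreal (1 / (real n)\<^sup>2 * (\<Sum>i\<in>I. 1))"
    using var by (intro ennreal_leI mult_left_mono sum_mono) auto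
  also have "1 / (real n)\<^sup>2 * (\<Sum>i\<in>I. 1) = 1 / n"
    using n by (simp add: n_def power2_eq_square)
  finally show ?thesis unfolding n_def .
qed

definition empirical_char :: "(nat \<Rightarrow> 'a \<Rightarrow> real) \<Rightarrow> nat \<Rightarrow> 'a \<Rightarrow> real \<Rightarrow> complex" where
  "empirical_char X n \<omega> t = (\<Sum>j=1..n. iexp (t * X j \<omega>)) / of_nat n"

lemma cmod_empirical_char_le_1: "cmod (empirical_char X n \<omega> t) \<le> 1"
proof -
  have "cmod (\<Sum>j=1..n. iexp (t * X j \<omega>)) \<le> real n"
    using sum_norm_bound[of "{1..n}" "\<lambda>j. iexp (t * X j \<omega>)" 1] by simp
  then show ?thesis by (simp add: empirical_char_def norm_divide divide_le_eq)
qed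

text \<open>The factor \<open>iexp (t * X j \<omega>)\<close> translates the kernel to the
  observation \<open>X j \<omega>\<close>; linearity over the sample does the rest.\<close>

lemma sinc_estimator_eq_inverse_fourier:
  assumes h: "h > 0"
  shows "of_real (sinc_estimator X n h \<omega> x) = 1 / (2 * pi) *
    (\<integral>t. (indicator {-(1/h)..1/h} t *\<^sub>R empirical_char X n \<omega> t) * iexp (- (x * t)) \<partial>lborel)"
proof -
  let ?A = "{-(1/h)..1/h}"
  have i: "integrable lborel (\<lambda>t. indicator ?A t *\<^sub>R iexp (- ((x - X j \<omega>) * t)))" for j
    by (rule Bochner_Integration.integrable_bound[of _ "indicator ?A :: real \<Rightarrow> real"])
       (use h in \<open>auto split: split_indicator\<close>)
  have "(\<integral>t. (indicator ?A t *\<^sub>R empirical_char X n \<omega> t) * iexp (- (x * t)) \<partial>lborel) =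
      (\<integral>t. (\<Sum>j=1..n. 1 / of_nat n * (indicator ?A t *\<^sub>R iexp (- ((x - X j \<omega>) * t)))) \<partial>lborel)"
  proof (rule Bochner_Integration.integral_cong[OF refl])
    fix t :: real
    have "iexp (t * X j \<omega>) * iexp (- (x * t)) = iexp (- ((x - X j \<omega>) * t))" for j
      by (simp add: algebra_simps flip: exp_add)
    then show "(indicator ?A t *\<^sub>R empirical_char X n \<omega> t) * iexp (- (x * t)) =
        (\<Sum>j=1..n. 1 / of_nat n * (indicator ?A t *\<^sub>R iexp (- ((x - X j \<omega>) * t))))"
      by (simp only: empirical_char_def scaleR_conv_of_real sum_distrib_left sum_distrib_right
        sum_divide_distrib) (simp add: mult_ac divide_inverse)
  qed
  also have "\<dots> = (\<Sum>j=1..n. 1 / of_nat n * (CLBINT t:?A. iexp (- ((x - X j \<omega>) * t))))"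
    unfolding set_lebesgue_integral_def using i
    by (subst Bochner_Integration.integral_sum) (auto simp only: integral_mult_right_zero integrable_mult_right)
  also have "1 / (2 * pi) * \<dots> = (\<Sum>j=1..n. of_real (1 / n * (sinc_kernel ((x - X j \<omega>) / h) / h)))"
    by (simp only: of_real_mult sinc_kernel_eq_integral[OF h] sum_distrib_left) (simp add: mult_ac)
  also have "\<dots> = of_real (sinc_estimator X n h \<omega> x)"
    by (simp add: sinc_estimator_def sum_distrib_left)
  finally show ?thesis ..
qed

section \<open>Bounding the MISE by variance and squared bias in the frequency domain\<close>

text \<open>The Plancherel inequality is applied for each fixed \<open>\<omega>\<close>; Tonelli
  then moves the expectation inside the frequency integral, where it is a variance for frequencies
  up to \<open>1 / h\<close> and the nonrandom squared bias beyond.\<close>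

lemma MISE_sinc_estimator_le:
  fixes M :: "'a measure" and X :: "nat \<Rightarrow> 'a \<Rightarrow> real" and p :: "real \<Rightarrow> real"
  assumes "prob_space M" and n: "n \<ge> 1"
    and ind: "prob_space.indep_vars M (\<lambda>_. borel) X {1..n}"
    and p0: "\<And>x. p x \<ge> 0"
    and dist: "\<And>j. j \<in> {1..n} \<Longrightarrow> distributed M lborel (X j) (\<lambda>x. ennreal (p x))"
    and int: "integrable lborel (density_cf p)"
    and h: "h > 0"
  shows "MISE M (sinc_estimator X n h) p \<le> ennreal (1 / (2 * pi)) *
    (\<integral>\<^sup>+t. (if \<bar>t\<bar> \<le> 1 / h then ennreal (1 / n) else ennreal ((cmod (density_cf p t))\<^sup>2)) \<partial>lborel)"
proof -
  interpret prob_space M by fact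
  interpret P: pair_sigma_finite M "lborel :: real measure" ..
  define f where "f = density_cf p"
  have fi: "integrable lborel f" using int by (simp add: f_def)
  then have [measurable]: "f \<in> borel_measurable borel"
    by (simp add: borel_measurable_integrable[of lborel, simplified])
  have [measurable]: "X j \<in> borel_measurable M" if "j \<in> {1..n}" for j
    using ind that by (auto simp: indep_vars_def)
  have d: "distr M lborel (X j) = density lborel (\<lambda>x. ennreal (p x))" if "j \<in> {1..n}" for j
    using dist[OF that] by (simp add: distributed_def)
  have one: "1 \<in> {1..n}" using n by simp
  \<comment> \<open>The distribution hypothesis gives measurability of \<open>ennreal (p x)\<close>
    only; \<open>enn2real\<close> recovers \<open>p\<close> because \<open>p\<close> is
    nonnegative.\<close>
  have "(\<lambda>x. enn2real (ennreal (p x))) \<in> borel_measurable borel"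
    using distributed_borel_measurable[OF dist[OF one]] by simp
  then have [measurable]: "p \<in> borel_measurable borel" by (simp add: p0)
  have prob: "prob_space (density lborel (\<lambda>x. ennreal (p x)))"
    unfolding d[OF one, symmetric] using one by (intro prob_space_distr) simp
  have mean: "(\<integral>\<omega>. iexp (t * X j \<omega>) \<partial>M) = f t" if "j \<in> {1..n}" for j t
    unfolding f_def density_cf_def char_def d[OF that, symmetric]
    using that by (subst integral_distr) auto
  let ?A = "{-(1/h)..1/h}"
  have [measurable]: "(\<lambda>(\<omega>, t). empirical_char X n \<omega> t) \<in> borel_measurable (M \<Otimes>\<^sub>M lborel)"
    unfolding empirical_char_def by measurable
  have [measurable]: "empirical_char X n \<omega> \<in> borel_measurable borel" for \<omega>
    unfolding empirical_char_def by measurable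
  define g where "g \<omega> t = indicator ?A t *\<^sub>R empirical_char X n \<omega> t - f t" for \<omega> t
  have [measurable]: "case_prod g \<in> borel_measurable (M \<Otimes>\<^sub>M lborel)"
    unfolding g_def by measurable
  have ei: "integrable lborel (\<lambda>t. indicator ?A t *\<^sub>R empirical_char X n \<omega> t)" for \<omega>
    by (rule Bochner_Integration.integrable_bound[of _ "indicator ?A :: real \<Rightarrow> real"])
       (use h in \<open>auto simp: cmod_empirical_char_le_1 intro!: AE_I2 split: split_indicator\<close>)
  have gi: "integrable lborel (g \<omega>)" for \<omega>
    unfolding g_def using ei fi by (rule Bochner_Integration.integrable_diff)
  have "AE x in lborel. p x = Re (1 / (2 * pi) * (\<integral>t. f t * iexp (- (x * t)) \<partial>lborel))"
    using AE_density_eq_inverse_fourier[OF _ p0 prob] int by (simp add: f_def density_cf_def)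
  \<comment> \<open>The error is the real part of the inverse transform of
    \<open>g \<omega>\<close>, so the modulus bounds it. The exceptional null set comes from
    inversion for \<open>p\<close> and does not depend on \<open>\<omega>\<close>.\<close>
  then have err: "AE x in lborel. ennreal ((sinc_estimator X n h \<omega> x - p x)\<^sup>2) \<le>
      ennreal (1 / (2 * pi)\<^sup>2) * ennreal ((cmod (\<integral>t. g \<omega> t * iexp (- (x * t)) \<partial>lborel))\<^sup>2)" for \<omega>
  proof eventually_elim
    case (elim x)
    define E where "E = (\<integral>t. g \<omega> t * iexp (- (x * t)) \<partial>lborel)"
    have "sinc_estimator X n h \<omega> x = Re (of_real (sinc_estimator X n h \<omega> x))" by simp
    then have "sinc_estimator X n h \<omega> x - p x = Re (1 / (2 * pi) * E)"
      unfolding elim sinc_estimator_eq_inverse_fourier[OF h] E_def g_def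
      using integrable_iexp_mult[OF ei, of \<omega> "- x"] integrable_iexp_mult[OF fi, of "- x"]
      by (simp add: left_diff_distrib Bochner_Integration.integral_diff right_diff_distrib diff_divide_distrib)
    then have "\<bar>sinc_estimator X n h \<omega> x - p x\<bar> \<le> cmod (1 / (2 * pi) * E)"
      using abs_Re_le_cmod by metis
    then have "(sinc_estimator X n h \<omega> x - p x)\<^sup>2 \<le> (cmod (1 / (2 * pi) * E))\<^sup>2"
      by (simp add: abs_le_square_iff[symmetric])
    also have "\<dots> = 1 / (2 * pi)\<^sup>2 * (cmod E)\<^sup>2"
      by (simp add: norm_mult norm_divide power_divide power_mult_distrib)
    finally show ?case
      unfolding E_def by (simp add: ennreal_leI flip: ennreal_mult')
  qed
  have [measurable]: "(\<lambda>x. \<integral>t. g \<omega> t * iexp (- (x * t)) \<partial>lborel) \<in> borel_measurable lborel" for \<omega>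
    using gi[of \<omega>, THEN borel_measurable_integrable] by measurable
  have "MISE M (sinc_estimator X n h) p \<le>
      (\<integral>\<^sup>+\<omega>. ennreal (1 / (2 * pi)) * (\<integral>\<^sup>+t. ennreal ((cmod (g \<omega> t))\<^sup>2) \<partial>lborel) \<partial>M)"
    unfolding MISE_def
  proof (rule nn_integral_mono)
    fix \<omega>
    have "(\<integral>\<^sup>+x. ennreal ((sinc_estimator X n h \<omega> x - p x)\<^sup>2) \<partial>lborel) \<le>
        (\<integral>\<^sup>+x. ennreal (1 / (2 * pi)\<^sup>2) * ennreal ((cmod (\<integral>t. g \<omega> t * iexp (- (x * t)) \<partial>lborel))\<^sup>2) \<partial>lborel)"
      by (rule nn_integral_mono_AE[OF err])
    also have "\<dots> = ennreal (1 / (2 * pi)\<^sup>2) * (\<integral>\<^sup>+x. ennreal ((cmod (\<integral>t. g \<omega> t * iexp (- (x * t)) \<partial>lborel))\<^sup>2) \<partial>lborel)"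
      by (rule nn_integral_cmult) measurable
    also have "\<dots> \<le> ennreal (1 / (2 * pi)\<^sup>2) * (ennreal (2 * pi) * (\<integral>\<^sup>+t. ennreal ((cmod (g \<omega> t))\<^sup>2) \<partial>lborel))"
      by (intro mult_left_mono nn_integral_fourier_le gi) simp
    \<comment> \<open>The squared factor of the inverse transform and the \<open>2 * pi\<close> of
      Plancherel combine to \<open>1 / (2 * pi)\<close>.\<close>
    also have "\<dots> = ennreal (1 / (2 * pi)) * (\<integral>\<^sup>+t. ennreal ((cmod (g \<omega> t))\<^sup>2) \<partial>lborel)"
      by (simp add: mult.assoc[symmetric] ennreal_mult'[symmetric] power2_eq_square)
    finally show "(\<integral>\<^sup>+x. ennreal ((sinc_estimator X n h \<omega> x - p x)\<^sup>2) \<partial>lborel) \<le>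
        ennreal (1 / (2 * pi)) * (\<integral>\<^sup>+t. ennreal ((cmod (g \<omega> t))\<^sup>2) \<partial>lborel)" .
  qed
  also have "\<dots> = ennreal (1 / (2 * pi)) * (\<integral>\<^sup>+\<omega>. (\<integral>\<^sup>+t. ennreal ((cmod (g \<omega> t))\<^sup>2) \<partial>lborel) \<partial>M)"
    by (rule nn_integral_cmult) measurable
  also have "(\<integral>\<^sup>+\<omega>. (\<integral>\<^sup>+t. ennreal ((cmod (g \<omega> t))\<^sup>2) \<partial>lborel) \<partial>M) =
      (\<integral>\<^sup>+t. (\<integral>\<^sup>+\<omega>. ennreal ((cmod (g \<omega> t))\<^sup>2) \<partial>M) \<partial>lborel)"
    by (rule P.Fubini'[symmetric]) measurable
  also have "\<dots> \<le> (\<integral>\<^sup>+t. (if \<bar>t\<bar> \<le> 1 / h then ennreal (1 / n) else ennreal ((cmod (f t))\<^sup>2)) \<partial>lborel)"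
  proof (rule nn_integral_mono)
    fix t :: real
    show "(\<integral>\<^sup>+\<omega>. ennreal ((cmod (g \<omega> t))\<^sup>2) \<partial>M) \<le>
        (if \<bar>t\<bar> \<le> 1 / h then ennreal (1 / n) else ennreal ((cmod (f t))\<^sup>2))"
    proof (cases "\<bar>t\<bar> \<le> 1 / h")
      case True
      then have "t \<in> ?A" by auto
      then show ?thesis
        using expectation_empirical_char_le[OF ind _ _ mean, of t] n True
        by (simp add: g_def empirical_char_def)
    next
      case False
      then have "t \<notin> ?A" by auto
      \<comment> \<open>Beyond the cutoff \<open>g \<omega> t = - f t\<close> is constant in
        \<open>\<omega>\<close>, and \<open>M\<close> has total mass 1.\<close>
      then show ?thesis using False by (simp add: g_def emeasure_space_1)
    qed
  qed
  finally show ?thesis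
    unfolding f_def by (simp add: mult_left_mono)
qed

section \<open>The choice of bandwidth and the tail of the characteristic function\<close>

theorem theorem9:
  fixes M :: "'a measure" and X :: "nat \<Rightarrow> 'a \<Rightarrow> real" and p :: "real \<Rightarrow> real"
    and n :: nat and \<alpha> \<gamma> h0 h :: real
  assumes "prob_space M"
    and "n \<ge> 1"
    and "prob_space.indep_vars M (\<lambda>_. borel) X {1..n}"
    and "\<And>x. p x \<ge> 0"
    and "\<And>j. j \<in> {1..n} \<Longrightarrow> distributed M lborel (X j) (\<lambda>x. ennreal (p x))"
    and "\<alpha> > 0" and "\<gamma> > 0"
    and "cf_exp_moment p \<alpha> \<gamma> < \<infinity>"
    and "h0 > 1 / real n"
    and "h = (1 / \<gamma> * ln (h0 * real n)) powr (- (1 / \<alpha>))"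
  shows "MISE M (sinc_estimator X n h) p
    \<le> ennreal (1 / (2 * pi * real n) *
        (2 / \<gamma> powr (1 / \<alpha>) * (ln h0 + ln (real n)) powr (1 / \<alpha>)
          + enn2real (cf_exp_moment p \<alpha> \<gamma>) / h0))"
proof -
  interpret prob_space M by fact
  define f where "f = density_cf p"
  define B where "B = enn2real (cf_exp_moment p \<alpha> \<gamma>)"
  define T where "T = 1 / h"
  have n: "real n > 0" using \<open>n \<ge> 1\<close> by simp
  have h0: "h0 > 0" using \<open>h0 > 1 / real n\<close> n by (meson divide_pos_pos less_trans zero_less_one)
  have hn: "h0 * real n > 1" using \<open>h0 > 1 / real n\<close> n by (simp add: field_simps)
  define L where "L = ln (h0 * real n)"
  have L: "L > 0" using hn by (simp add: L_def)
  have h: "h > 0" using L \<open>\<gamma> > 0\<close> by (simp add: assms(10) flip: L_def)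
  have T: "T = (L / \<gamma>) powr (1 / \<alpha>)"
    by (simp add: T_def assms(10) powr_minus_divide flip: L_def)
  have T0: "T > 0" using h by (simp add: T_def)
  have LT: "L = ln h0 + ln (real n)" using h0 n by (simp add: L_def ln_mult)
  \<comment> \<open>The balance behind the bandwidth: at the cutoff frequency \<open>T\<close> the
    exponential weight equals \<open>exp L = h0 * n\<close>.\<close>
  have Ta: "\<gamma> * T powr \<alpha> = L"
    using L \<open>\<alpha> > 0\<close> \<open>\<gamma> > 0\<close> by (simp add: T powr_powr)
  \<comment> \<open>Finiteness of the moment enters here: \<open>enn2real\<close> would send an
    infinite value to 0.\<close>
  have B: "ennreal B = (\<integral>\<^sup>+t. ennreal (exp (\<gamma> * \<bar>t\<bar> powr \<alpha>) * cmod (f t)) \<partial>lborel)"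
    using assms(8) unfolding B_def f_def by (simp add: cf_exp_moment_def)
  have B0: "B \<ge> 0" by (simp add: B_def)
  have one: "1 \<in> {1..n}" using \<open>n \<ge> 1\<close> by simp
  have X1: "X 1 \<in> borel_measurable M"
    using assms(3) one by (auto simp: indep_vars_def)
  have d1: "density lborel (\<lambda>x. ennreal (p x)) = distr M lborel (X 1)"
    using assms(5)[OF one] by (simp add: distributed_def)
  interpret D: prob_space "density lborel (\<lambda>x. ennreal (p x))"
    unfolding d1 using X1 by (intro prob_space_distr) simp
  interpret D: real_distribution "density lborel (\<lambda>x. ennreal (p x))"
    by unfold_locales simp_all
  have [measurable]: "f \<in> borel_measurable borel"
    unfolding f_def density_cf_def by (rule D.char_measurable)
  have f1: "cmod (f t) \<le> 1" for t
    unfolding f_def density_cf_def by (rule D.cmod_char_le_1)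
  \<comment> \<open>The exponential weight is at least 1, so the integral of
    \<open>\<bar>f\<bar>\<close> is at most \<open>B\<close>.\<close>
  have fi: "integrable lborel f"
  proof (rule integrableI_bounded)
    have "(\<integral>\<^sup>+t. ennreal (norm (f t)) \<partial>lborel) \<le> ennreal B"
      unfolding B using \<open>\<gamma> > 0\<close>
      by (intro nn_integral_mono ennreal_leI mult_right_le_one_le[THEN order_trans, OF _ _ _ order_refl])
        (auto intro!: mult_le_cancel_right1[THEN iffD2])
    then show "(\<integral>\<^sup>+t. ennreal (norm (f t)) \<partial>lborel) < \<infinity>"
      using le_less_trans by fastforce
  qed simp
  have tail: "(cmod (f t))\<^sup>2 \<le> 1 / (h0 * n) * (exp (\<gamma> * \<bar>t\<bar> powr \<alpha>) * cmod (f t))" if t: "\<bar>t\<bar> > T" for t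
  proof -
    have "L \<le> \<gamma> * \<bar>t\<bar> powr \<alpha>"
      unfolding Ta[symmetric] using t T0 \<open>\<alpha> > 0\<close> \<open>\<gamma> > 0\<close>
      by (intro mult_left_mono powr_mono2) auto
    then have "exp L \<le> exp (\<gamma> * \<bar>t\<bar> powr \<alpha>)" by simp
    then have "h0 * n \<le> exp (\<gamma> * \<bar>t\<bar> powr \<alpha>)"
      using hn by (simp add: L_def)
    then have "1 \<le> 1 / (h0 * n) * exp (\<gamma> * \<bar>t\<bar> powr \<alpha>)"
      using hn by (simp add: field_simps)
    then have "1 * cmod (f t) \<le> 1 / (h0 * n) * exp (\<gamma> * \<bar>t\<bar> powr \<alpha>) * cmod (f t)"
      by (rule mult_right_mono) simp
    moreover have "(cmod (f t))\<^sup>2 \<le> cmod (f t)"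
      using f1[of t] by (simp add: power2_eq_square mult_left_le)
    ultimately show ?thesis by simp
  qed
  have "MISE M (sinc_estimator X n h) p \<le> ennreal (1 / (2 * pi)) *
      (\<integral>\<^sup>+t. (if \<bar>t\<bar> \<le> T then ennreal (1 / n) else ennreal ((cmod (f t))\<^sup>2)) \<partial>lborel)"
    unfolding f_def T_def using assms fi h by (intro MISE_sinc_estimator_le) (auto simp: f_def)
  \<comment> \<open>The tail bound is nonnegative and is therefore added on the whole line, which
    makes its integral the full moment \<open>B\<close>; the indicator contributes the length
    \<open>2 * T\<close>.\<close>
  also have "(\<integral>\<^sup>+t. (if \<bar>t\<bar> \<le> T then ennreal (1 / n) else ennreal ((cmod (f t))\<^sup>2)) \<partial>lborel) \<le>
      (\<integral>\<^sup>+t. ennreal (1 / n) * indicator {-T..T} t +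
        ennreal (1 / (h0 * n)) * ennreal (exp (\<gamma> * \<bar>t\<bar> powr \<alpha>) * cmod (f t)) \<partial>lborel)"
    using tail h0 n
    by (intro nn_integral_mono) (auto simp: not_le ennreal_leI simp flip: ennreal_mult' split: split_indicator)
  also have "\<dots> = ennreal (1 / n) * ennreal (2 * T) + ennreal (1 / (h0 * n)) * ennreal B"
    using T0 by (subst nn_integral_add) (auto simp: nn_integral_cmult nn_integral_cmult_indicator B)
  also have "ennreal (1 / (2 * pi)) * \<dots> = ennreal (1 / (2 * pi) * (1 / n * (2 * T) + 1 / (h0 * n) * B))"
  proof -
    have "0 \<le> 1 / (2 * pi)" "0 \<le> 1 / real n" "0 \<le> 1 / (h0 * n)"
      "0 \<le> 1 / n * (2 * T)" "0 \<le> 1 / (h0 * n) * B"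
      using T0 B0 h0 by simp_all
    then show ?thesis
      by (simp only: ennreal_mult'[symmetric] ennreal_plus[symmetric])
  qed
  also have "1 / (2 * pi) * (1 / n * (2 * T) + 1 / (h0 * n) * B) = 1 / (2 * pi * n) * (2 * T + B / h0)"
    using n h0 by (simp add: field_simps)
  also have "2 * T = 2 / \<gamma> powr (1 / \<alpha>) * (ln h0 + ln (real n)) powr (1 / \<alpha>)"
    using L \<open>\<gamma> > 0\<close> by (simp add: T powr_divide flip: LT)
  finally show ?thesis
    unfolding B_def by (simp add: mult_left_mono)
qed

end
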